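(* Let $k$ be an algebraically closed field. Then the ring $k[T]_{\mathbb{Q}}$ of polynomials with rational degree in one variable is a Bézout domain.
   Context: For a field $k$, the ring of polynomials with rational degree in one variable is the direct limit (union) $k[T]_{\mathbb{Q}}=\varinjlim_i k[T,T^{1/2},\ldots,T^{1/i}]=\bigcup_{i\ge 1} k[T,T^{1/2},\ldots,T^{1/i}]$, where $T^{1/i}$, $i\in\mathbb{Z}_{>0}$, are formally adjoined compatible roots of $T$. Equivalently, its elements are finite $k$-linear combinations of monomials $T^{r}$ with $r\in\mathbb{Q}_{\ge 0}$, multiplied by $T^rT^s=T^{r+s}$. A Bézout domain is an integral domain in which every finitely generated ideal is principal. *)

theory Defs
  imports
    "HOL-Algebra.Algebra"
    "HOL-Algebra.Algebraic_Closure_Type"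
    "HOL-Library.Poly_Mapping"
begin

text \<open>
  The group algebra \<open>k[\<rat>]\<close> (finitely supported functions \<open>\<rat> \<rightarrow> k\<close> with convolution) serves as an
  ambient ring. Its monomials \<open>T\<^sup>r\<close> provide compatible roots of \<open>T\<close>, so that the direct limit of the
  rings generated over \<open>k\<close> by the \<open>j\<close>-th roots of \<open>T\<close> with \<open>1 \<le> j \<le> i\<close> can be taken as a union of
  subrings.
\<close>

definition rat_monom :: "rat \<Rightarrow> (rat \<Rightarrow>\<^sub>0 'k :: field)" where
  "rat_monom r = Poly_Mapping.single r 1"

definition rat_const :: "'k :: field \<Rightarrow> (rat \<Rightarrow>\<^sub>0 'k)" where
  "rat_const c = Poly_Mapping.single 0 c"

definition polys_with_roots :: "nat \<Rightarrow> (rat \<Rightarrow>\<^sub>0 'k :: field) set" where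
  "polys_with_roots i =
     generate_ring ring_of_type_algebra
       (rat_const ` UNIV \<union> (\<lambda>j. rat_monom (1 / of_nat j)) ` {1..i})"

definition rat_poly_ring :: "(rat \<Rightarrow>\<^sub>0 'k :: field) ring" where
  "rat_poly_ring = ring_of_type_algebra \<lparr>carrier := (\<Union>i\<in>{1..}. polys_with_roots i)\<rparr>"

locale bezout_domain = domain R for R (structure) +
  assumes finitely_generated_principal:
    "finite S \<Longrightarrow> S \<subseteq> carrier R \<Longrightarrow> principalideal (Idl S) R"

lemma ring_of_poly_mapping_simps [simp]:
  "x \<otimes>\<^bsub>ring_of_type_algebra\<^esub> y = x * (y :: rat \<Rightarrow>\<^sub>0 'k :: field)"
  "x \<oplus>\<^bsub>ring_of_type_algebra\<^esub> y = x + (y :: rat \<Rightarrow>\<^sub>0 'k :: field)"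
  "\<one>\<^bsub>ring_of_type_algebra\<^esub> = (1 :: rat \<Rightarrow>\<^sub>0 'k :: field)"
  "\<zero>\<^bsub>ring_of_type_algebra\<^esub> = (0 :: rat \<Rightarrow>\<^sub>0 'k :: field)"
  "carrier ring_of_type_algebra = (UNIV :: (rat \<Rightarrow>\<^sub>0 'k :: field) set)"
  by (simp_all add: ring_of_type_algebra_def)

lemma ring_of_poly_mapping_uminus [simp]:
  "\<ominus>\<^bsub>ring_of_type_algebra\<^esub> x = - (x :: rat \<Rightarrow>\<^sub>0 'k :: field)"
proof -
  interpret ring "ring_of_type_algebra :: (rat \<Rightarrow>\<^sub>0 'k) ring"
    by (rule ring_from_type_algebra)
  show ?thesis
    by (rule minus_equality) simp_all
qed

lemma keys_polys_with_roots:
  assumes "p \<in> polys_with_roots i"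
  shows "Poly_Mapping.keys p \<subseteq> {0..}"
  using assms unfolding polys_with_roots_def
proof (induction rule: generate_ring.induct)
  case (eng_add p q)
  then show ?case
    using Poly_Mapping.keys_add[of p q] by auto
next
  case (eng_mult p q)
  then show ?case
    using Poly_Mapping.keys_mult[of p q] by fastforce
qed (auto simp: rat_monom_def rat_const_def split: if_splits)

lemma polys_with_roots_mono: "i \<le> j \<Longrightarrow> polys_with_roots i \<subseteq> polys_with_roots j"
proof
  fix p :: "rat \<Rightarrow>\<^sub>0 'k :: field"
  assume "i \<le> j" "p \<in> polys_with_roots i"
  from this(2) show "p \<in> polys_with_roots j"
    unfolding polys_with_roots_def
  proof (induction rule: generate_ring.induct)
    case (incl h)
    with \<open>i \<le> j\<close> show ?case
      by (intro generate_ring.incl) auto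
  qed (auto intro: generate_ring.one generate_ring.a_inv generate_ring.eng_add generate_ring.eng_mult
        simp del: ring_of_poly_mapping_simps ring_of_poly_mapping_uminus)
qed

lemma single_in_polys_with_roots:
  assumes "r \<ge> 0"
  shows "\<exists>i\<ge>1. Poly_Mapping.single r c \<in> polys_with_roots i"
proof -
  obtain a b where ab: "quotient_of r = (a, b)"
    by fastforce
  define n m where "n = nat a" and "m = nat b"
  have b: "b > 0"
    using ab quotient_of_denom_pos by blast
  have r: "r = of_int a / of_int b"
    using ab quotient_of_div by blast
  have a: "a \<ge> 0"
    using assms b r by (simp add: zero_le_divide_iff)
  have r': "r = of_nat n * (1 / of_nat m)"
    using a b by (simp add: r n_def m_def)
  have m: "m \<ge> 1"
    using b by (simp add: m_def)
  have "Poly_Mapping.single (of_nat l * (1 / of_nat m)) c \<in> polys_with_roots m" for l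
  proof (induction l)
    case 0
    show ?case
      unfolding polys_with_roots_def
      by (rule generate_ring.incl) (auto simp: rat_const_def)
  next
    case (Suc l)
    have "rat_monom (1 / of_nat m) \<in> polys_with_roots m"
      unfolding polys_with_roots_def using m by (intro generate_ring.incl) auto
    from generate_ring.eng_mult[OF this[unfolded polys_with_roots_def]
        Suc[unfolded polys_with_roots_def]]
    show ?case
      by (simp add: polys_with_roots_def rat_monom_def mult_single add_divide_distrib)
  qed
  from this[of n] show ?thesis
    using m by (auto simp: r' simp del: of_nat_mult)
qed

lemma carrier_rat_poly_ring:
  "carrier (rat_poly_ring :: (rat \<Rightarrow>\<^sub>0 'k :: field) ring) = {p. Poly_Mapping.keys p \<subseteq> {0..}}"
proof (intro equalityI subsetI)
  fix p :: "rat \<Rightarrow>\<^sub>0 'k"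
  assume "p \<in> carrier rat_poly_ring"
  then show "p \<in> {p. Poly_Mapping.keys p \<subseteq> {0..}}"
    using keys_polys_with_roots by (auto simp: rat_poly_ring_def)
next
  fix p :: "rat \<Rightarrow>\<^sub>0 'k"
  assume "p \<in> {p. Poly_Mapping.keys p \<subseteq> {0..}}"
  then have p: "Poly_Mapping.keys p \<subseteq> {0..}" by simp
  have "\<exists>i\<ge>1. (\<Sum>r\<in>A. Poly_Mapping.single r (Poly_Mapping.lookup p r)) \<in> polys_with_roots i"
    if "finite A" "A \<subseteq> {0..}" for A
    using that
  proof (induction A rule: finite_induct)
    case empty
    show ?case
      using single_in_polys_with_roots[of 0 0] by simp
  next
    case (insert r A)
    obtain i where i: "i \<ge> 1"
      "(\<Sum>r\<in>A. Poly_Mapping.single r (Poly_Mapping.lookup p r)) \<in> polys_with_roots i"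
      using insert by auto
    obtain j where j: "j \<ge> 1"
      "Poly_Mapping.single r (Poly_Mapping.lookup p r) \<in> polys_with_roots j"
      using insert single_in_polys_with_roots[of r] by auto
    have "Poly_Mapping.single r (Poly_Mapping.lookup p r) \<in> polys_with_roots (max i j)"
      "(\<Sum>r\<in>A. Poly_Mapping.single r (Poly_Mapping.lookup p r)) \<in> polys_with_roots (max i j)"
      using i j polys_with_roots_mono[of i "max i j"] polys_with_roots_mono[of j "max i j"]
      by auto
    from generate_ring.eng_add[OF this[unfolded polys_with_roots_def]] i insert
    show ?case
      by (intro exI[of _ "max i j"]) (simp add: polys_with_roots_def)
  qed
  moreover have "(\<Sum>r\<in>Poly_Mapping.keys p. Poly_Mapping.single r (Poly_Mapping.lookup p r)) = p"
    by (rule poly_mapping_eqI)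
       (auto simp: lookup_sum lookup_single when_def in_keys_iff)
  ultimately have "\<exists>i\<ge>1. p \<in> polys_with_roots i"
    using p by (metis (lifting) finite_keys)
  then show "p \<in> carrier rat_poly_ring"
    by (auto simp: rat_poly_ring_def)
qed

end

(*
  Finitely many elements of the ring have a common denominator n for their exponents, so they
  all lie in the image of the one-variable polynomial ring under X \<mapsto> T^(1/n), where the Euclidean
  algorithm yields Bezout identities.
*)
theory Submission
  imports Defs
begin

text \<open>Euclid's algorithm, as induction on the size of \<open>b\<close>: the pair
  (\<open>a\<close>, \<open>b\<close>) is replaced by (\<open>b\<close>, \<open>a mod b\<close>).
  Asking only for some common divisor \<open>d\<close> avoids choosing a normalised gcd.\<close>

lemma bezout_identity_euclidean_ring:
  fixes a b :: "'a :: euclidean_ring"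
  shows "\<exists>d u v. d = u * a + v * b \<and> d dvd a \<and> d dvd b"
proof (induction "euclidean_size b" arbitrary: a b rule: less_induct)
  case less
  show ?case
  proof (cases "b = 0")
    case True
    then show ?thesis
      by (intro exI[of _ a] exI[of _ 1] exI[of _ 0]) simp
  next
    case False
    then obtain d u v where d: "d = u * b + v * (a mod b)" "d dvd b" "d dvd a mod b"
      using less[of "a mod b" b] mod_size_less by blast
    \<comment> \<open>Back-substitution of \<open>a mod b = a - (a div b) * b\<close> into the
      identity for the smaller pair.\<close>
    have "d = v * a + (u - v * (a div b)) * b"
      using d(1) by (simp add: minus_div_mult_eq_mod[symmetric] algebra_simps)
    moreover have "d dvd a"
      using d(2,3) by (simp add: dvd_mod_iff)
    ultimately show ?thesis
      using d(2) by blast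
  qed
qed

text \<open>For positive \<open>n\<close> this is the embedding of k[X] into the group algebra k[Q]
  that sends X to T^(1/n). At \<open>n = 0\<close> division by zero makes the exponent 0, so X is
  sent to 1.\<close>

definition poly_subst_root :: "nat \<Rightarrow> 'k :: field poly \<Rightarrow> (rat \<Rightarrow>\<^sub>0 'k)" where
  "poly_subst_root n p = poly (map_poly rat_const p) (rat_monom (1 / of_nat n))"

lemma rat_const_0 [simp]: "rat_const 0 = 0"
  by (simp add: rat_const_def)

lemma poly_subst_root_0 [simp]: "poly_subst_root n 0 = 0"
  by (simp add: poly_subst_root_def)

text \<open>Horner's recursion, on which the inductions for the homomorphism laws rest.\<close>

lemma poly_subst_root_pCons:
  "poly_subst_root n (pCons a p) = rat_const a + rat_monom (1 / of_nat n) * poly_subst_root n p"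
  by (simp add: poly_subst_root_def map_poly_pCons)

lemma poly_subst_root_add:
  "poly_subst_root n (p + q) = poly_subst_root n p + poly_subst_root n q"
  by (induction p q rule: poly_induct2)
     (simp_all add: poly_subst_root_pCons rat_const_def single_add algebra_simps)

lemma poly_subst_root_smult:
  "poly_subst_root n (smult a p) = rat_const a * poly_subst_root n p"
  by (induction p) (simp_all add: poly_subst_root_pCons rat_const_def mult_single algebra_simps)

lemma poly_subst_root_mult:
  "poly_subst_root n (p * q) = poly_subst_root n p * poly_subst_root n q"
  by (induction p)
     (simp_all add: poly_subst_root_pCons poly_subst_root_add poly_subst_root_smult algebra_simps)

lemma poly_subst_root_monom:
  "poly_subst_root n (monom c m) = Poly_Mapping.single (of_nat m / of_nat n) c"
  by (induction m)
     (simp_all add: monom_0 monom_Suc poly_subst_root_pCons rat_const_def rat_monom_def mult_single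
        add_divide_distrib)

text \<open>Constants and T^(1/n) have exponents at least 0, and sums and products preserve this.
  Hence cofactors and Bezout coefficients found in k[X] are mapped into the ring.\<close>

lemma keys_poly_subst_root: "Poly_Mapping.keys (poly_subst_root n p) \<subseteq> {0..}"
proof (induction p)
  case (pCons a p)
  have "Poly_Mapping.keys (rat_monom (1 / of_nat n) * poly_subst_root n p) \<subseteq> {0..}"
    using Poly_Mapping.keys_mult[of "rat_monom (1 / of_nat n)" "poly_subst_root n p"] pCons(2)
    by (fastforce simp: rat_monom_def split: if_splits)
  moreover have "Poly_Mapping.keys (rat_const a) \<subseteq> {0..}"
    by (simp add: rat_const_def)
  ultimately show ?case
    unfolding poly_subst_root_pCons
    using Poly_Mapping.keys_add[of "rat_const a" "rat_monom (1 / of_nat n) * poly_subst_root n p"]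
    by blast
qed simp

lemma sum_single_lookup:
  "(\<Sum>r\<in>Poly_Mapping.keys p. Poly_Mapping.single r (Poly_Mapping.lookup p r)) = p"
  by (rule poly_mapping_eqI) (auto simp: lookup_sum lookup_single when_def in_keys_iff)

lemma common_denominator:
  assumes "finite A" "A \<subseteq> {0 :: rat..}"
  shows "\<exists>n > 0. \<forall>r\<in>A. \<exists>m :: nat. r = of_nat m / of_nat n"
  using assms
proof (induction A rule: finite_induct)
  case (insert r A)
  obtain n where n: "n > 0" "\<forall>s\<in>A. \<exists>m :: nat. s = of_nat m / of_nat n"
    using insert by auto
  obtain a b where ab: "quotient_of r = (a, b)"
    by fastforce
  have b: "b > 0" and r: "r = of_int a / of_int b"
    using ab quotient_of_denom_pos quotient_of_div by blast+
  have a: "a \<ge> 0"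
    using insert.prems b r by (simp add: zero_le_divide_iff)
  \<comment> \<open>The new common denominator is the product of the old one with the denominator of
    \<open>r\<close>; the old fractions are expanded by \<open>nat b\<close>.\<close>
  have "r = of_nat (nat a * n) / of_nat (nat b * n)"
    using a b n(1) by (simp add: r)
  moreover have "\<exists>m :: nat. s = of_nat m / of_nat (nat b * n)" if s: "s \<in> A" for s
  proof -
    obtain m :: nat where "s = of_nat m / of_nat n"
      using n(2) s by blast
    then have "s = of_nat (nat b * m) / of_nat (nat b * n)"
      using b by simp
    then show ?thesis ..
  qed
  moreover have "nat b * n > 0"
    using b n(1) by simp
  ultimately show ?case
    by (metis insert_iff)
qed auto

text \<open>Each term of \<open>p\<close> is the image of a monomial, and the range is closed under
  addition. The induction runs over subsets of the support while the coefficients stay those of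
  \<open>p\<close>.\<close>

lemma in_range_poly_subst_root:
  assumes "\<And>r. r \<in> Poly_Mapping.keys p \<Longrightarrow> \<exists>m :: nat. r = of_nat m / of_nat n"
  shows "p \<in> range (poly_subst_root n)"
proof -
  have "(\<Sum>r\<in>A. Poly_Mapping.single r (Poly_Mapping.lookup p r)) \<in> range (poly_subst_root n)"
    if "finite A" "A \<subseteq> Poly_Mapping.keys p" for A
    using that
  proof (induction A rule: finite_induct)
    case empty
    show ?case
      using poly_subst_root_0[of n] by (metis rangeI sum.empty)
  next
    case (insert r A)
    then obtain q where "(\<Sum>r\<in>A. Poly_Mapping.single r (Poly_Mapping.lookup p r)) = poly_subst_root n q"
      by auto
    moreover obtain m :: nat where "r = of_nat m / of_nat n"
      using assms insert.prems by blast
    ultimately have "(\<Sum>r\<in>insert r A. Poly_Mapping.single r (Poly_Mapping.lookup p r)) =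
        poly_subst_root n (monom (Poly_Mapping.lookup p r) m + q)"
      using insert.hyps by (simp add: poly_subst_root_add poly_subst_root_monom)
    then show ?case
      by blast
  qed
  from this[of "Poly_Mapping.keys p"] show ?thesis
    by (simp add: sum_single_lookup)
qed

text \<open>Since the rationals are linearly ordered, the terms of extremal exponent in a product
  cannot cancel, so k[Q] has no zero divisors. This passes to the subring of elements with
  nonnegative exponents.\<close>

lemma domain_rat_poly_ring: "domain (rat_poly_ring :: (rat \<Rightarrow>\<^sub>0 'k :: field) ring)"
proof -
  let ?K = "ring_of_type_algebra :: (rat \<Rightarrow>\<^sub>0 'k) ring"
  let ?C = "{p :: rat \<Rightarrow>\<^sub>0 'k. Poly_Mapping.keys p \<subseteq> {0..}}"
  interpret K: cring ?K
    by (rule cring_from_type_algebra)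
  interpret K: domain ?K
    by unfold_locales auto
  have "subring ?C ?K"
  proof (rule K.subringI)
    show "h1 \<otimes>\<^bsub>?K\<^esub> h2 \<in> ?C" if "h1 \<in> ?C" "h2 \<in> ?C" for h1 h2
      using that Poly_Mapping.keys_mult[of h1 h2] by fastforce
    show "h1 \<oplus>\<^bsub>?K\<^esub> h2 \<in> ?C" if "h1 \<in> ?C" "h2 \<in> ?C" for h1 h2
      using that Poly_Mapping.keys_add[of h1 h2] by auto
  qed auto
  then have "domain (?K \<lparr>carrier := ?C\<rparr>)"
    using K.subdomain_iff[of ?C] K.subdomainI'[of ?C] by simp
  also have "?K \<lparr>carrier := ?C\<rparr> = rat_poly_ring"
    unfolding carrier_rat_poly_ring[symmetric] by (simp add: rat_poly_ring_def)
  finally show ?thesis .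
qed

lemma rat_poly_ring_simps [simp]:
  "x \<otimes>\<^bsub>rat_poly_ring\<^esub> y = x * (y :: rat \<Rightarrow>\<^sub>0 'k :: field)"
  "x \<oplus>\<^bsub>rat_poly_ring\<^esub> y = x + (y :: rat \<Rightarrow>\<^sub>0 'k :: field)"
  "\<zero>\<^bsub>rat_poly_ring\<^esub> = (0 :: rat \<Rightarrow>\<^sub>0 'k :: field)"
  by (simp_all add: rat_poly_ring_def ring_of_type_algebra_def)

text \<open>The Bezout identity and both divisibilities are transported from k[X] by the
  substitution homomorphism. The cofactors are required to lie in \<open>R\<close>, because
  divisibility in k[Q] is weaker: every monomial is a unit there.\<close>

lemma rat_poly_ring_bezout_identity:
  fixes a b :: "rat \<Rightarrow>\<^sub>0 'k :: field"
  defines "R \<equiv> rat_poly_ring :: (rat \<Rightarrow>\<^sub>0 'k) ring"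
  assumes "a \<in> carrier R" "b \<in> carrier R"
  shows "\<exists>u\<in>carrier R. \<exists>v\<in>carrier R. \<exists>x\<in>carrier R. \<exists>y\<in>carrier R.
           a = x * (u * a + v * b) \<and> b = y * (u * a + v * b)"
proof -
  have "finite (Poly_Mapping.keys a \<union> Poly_Mapping.keys b)"
    "Poly_Mapping.keys a \<union> Poly_Mapping.keys b \<subseteq> {0..}"
    using assms(2,3) by (auto simp: R_def carrier_rat_poly_ring)
  from common_denominator[OF this] obtain n where
    "\<forall>r \<in> Poly_Mapping.keys a \<union> Poly_Mapping.keys b. \<exists>m :: nat. r = of_nat m / of_nat n"
    by blast
  then obtain p q where pq: "a = poly_subst_root n p" "b = poly_subst_root n q"
    using in_range_poly_subst_root[of a n] in_range_poly_subst_root[of b n] by blast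
  obtain d u v where d: "d = u * p + v * q" and "d dvd p" "d dvd q"
    using bezout_identity_euclidean_ring by blast
  then obtain x y where xy: "p = x * d" "q = y * d"
    by (metis dvdE mult.commute)
  have d': "poly_subst_root n d = poly_subst_root n u * a + poly_subst_root n v * b"
    by (simp add: d pq poly_subst_root_add poly_subst_root_mult)
  have "a = poly_subst_root n x * poly_subst_root n d" "b = poly_subst_root n y * poly_subst_root n d"
    using pq xy poly_subst_root_mult by metis+
  moreover have "poly_subst_root n z \<in> carrier R" for z
    by (simp add: R_def carrier_rat_poly_ring keys_poly_subst_root)
  ultimately show ?thesis
    unfolding d' by blast
qed

theorem mainTheorem1:
  shows "bezout_domain (rat_poly_ring :: (rat \<Rightarrow>\<^sub>0 'k :: alg_closed_field) ring)"
proof -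
  let ?R = "rat_poly_ring :: (rat \<Rightarrow>\<^sub>0 'k) ring"
  interpret domain ?R
    by (rule domain_rat_poly_ring)
  show ?thesis
  proof (intro bezout_domain.intro bezout_domain_axioms.intro domain_axioms)
    fix S
    assume S: "finite S" "S \<subseteq> carrier ?R"
    \<comment> \<open>Such a \<open>d\<close> generates the ideal: one condition gives each
      inclusion. It is found by adding the generators one at a time.\<close>
    then have "\<exists>d \<in> Idl\<^bsub>?R\<^esub> S. S \<subseteq> PIdl\<^bsub>?R\<^esub> d"
    proof (induction S rule: finite_induct)
      case empty
      interpret I: ideal "Idl\<^bsub>?R\<^esub> {}" ?R
        by (rule genideal_ideal) simp
      \<comment> \<open>Zero is a witness, as the inclusion of the empty set is trivial.\<close>
      show ?case
        using I.zero_closed by blast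
    next
      case (insert a S)
      interpret I: ideal "Idl\<^bsub>?R\<^esub> (insert a S)" ?R
        by (rule genideal_ideal) (use insert.prems in simp)
      obtain b where b: "b \<in> Idl\<^bsub>?R\<^esub> S" "S \<subseteq> PIdl\<^bsub>?R\<^esub> b"
        using insert by auto
      have "insert a S \<subseteq> Idl\<^bsub>?R\<^esub> (insert a S)"
        using insert.prems by (rule genideal_self)
      then have a': "a \<in> Idl\<^bsub>?R\<^esub> (insert a S)" and b': "b \<in> Idl\<^bsub>?R\<^esub> (insert a S)"
        using b(1) genideal_minimal[OF I.is_ideal, of S] by auto
      have ab: "a \<in> carrier ?R" "b \<in> carrier ?R"
        using a' b' I.Icarr by auto
      \<comment> \<open>The element \<open>b\<close> stands in for all of \<open>S\<close>, so only
        the two generators \<open>a\<close> and \<open>b\<close> have to be merged.\<close>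
      obtain u v x y where uv: "u \<in> carrier ?R" "v \<in> carrier ?R" "x \<in> carrier ?R" "y \<in> carrier ?R"
        "a = x * (u * a + v * b)" "b = y * (u * a + v * b)"
        using rat_poly_ring_bezout_identity[OF ab] by blast
      define d where "d = u * a + v * b"
      have d: "d \<in> Idl\<^bsub>?R\<^esub> (insert a S)"
        using I.a_closed[OF I.I_l_closed[OF a' uv(1)] I.I_l_closed[OF b' uv(2)]] by (simp add: d_def)
      have "a \<in> PIdl\<^bsub>?R\<^esub> d" "b \<in> PIdl\<^bsub>?R\<^esub> d"
        using uv(3-6) by (auto simp: cgenideal_def d_def)
      \<comment> \<open>As \<open>b\<close> is a multiple of \<open>d\<close>, the elements of
        \<open>S\<close>, being multiples of \<open>b\<close>, are multiples of \<open>d\<close>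
        too.\<close>
      moreover from this(2) have "PIdl\<^bsub>?R\<^esub> b \<subseteq> PIdl\<^bsub>?R\<^esub> d"
        using d I.Icarr by (intro cgenideal_minimal cgenideal_ideal) auto
      ultimately show ?case
        using b(2) d by blast
    qed
    then obtain d where d: "d \<in> Idl\<^bsub>?R\<^esub> S" "S \<subseteq> PIdl\<^bsub>?R\<^esub> d"
      by blast
    have I: "ideal (Idl\<^bsub>?R\<^esub> S) ?R"
      using S(2) by (rule genideal_ideal)
    have d': "d \<in> carrier ?R"
      using ideal.Icarr[OF I d(1)] .
    have "Idl\<^bsub>?R\<^esub> S = PIdl\<^bsub>?R\<^esub> d"
      using cgenideal_minimal[OF I d(1)] genideal_minimal[OF cgenideal_ideal[OF d'] d(2)] by blast
    then show "principalideal (Idl\<^bsub>?R\<^esub> S) ?R"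
      using cgenideal_is_principalideal[OF d'] by simp
  qed
qed

end
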